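(* Let $\mathcal H=(V,E)$ be a hypergraph with associated bipartite graph $\mathrm{Bip}\,\mathcal H$. Then for every integer $k\ge0$: $y^i[X_{\mathcal H}]=\binom{|V|+i-2}{i}$ for all $i\le k$ if and only if $\mathrm{Bip}\,\mathcal H-E'$ is connected for every $E'\subset E$ with $|E'|=k$.
   Context: A hypergraph $\mathcal H=(V,E)$ has a finite vertex set $V$ and a finite multiset $E$ of nonempty subsets of $V$. $\mathrm{Bip}\,\mathcal H$ is the bipartite graph with color classes $V$ and $E$, $v\in V$ adjacent to $e\in E$ iff $v\in e$; $\mathrm{Bip}\,\mathcal H-E'$ is obtained by deleting the vertices in $E'$ (and incident edges). For $E''\subset E$ let $\mathrm{Bip}\,\mathcal H|_{E''}$ be the subgraph formed by $E''$, all edges incident to $E''$ and their endpoints in $V$; set $\mu(\emptyset)=0$ and $\mu(E'')=|\bigcup E''|-c(E'')$ otherwise, with $c(E'')$ the number of components of $\mathrm{Bip}\,\mathcal H|_{E''}$. $\mu$ is submodular and $P_{\mathcal H}=\{\mathbf a\in\mathbb{Z}^E\mid\sum_{e\in I}a_e\le\mu(I)\ \forall I\subset E,\ \sum_{e\in E}a_e=\mu(E)\}$. Fix a total order on $E$; for $\mathbf a\in P_{\mathcal H}$, $e$ is externally active if $\mathbf a+\mathbf e_e-\mathbf e_{e'}\notin P_{\mathcal H}$ for all $e'<e$. $X_{\mathcal H}(y)=\sum_{\mathbf a\in P_{\mathcal H}}y^{|E|-\#\text{externally active}}$ (independent of the order), and $y^i[X_{\mathcal H}]$ is its coefficient of 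$y^i$.
   Formalization: Proved for k ≤ |E|, and for k = 0 only when Bip H is connected; otherwise the claim fails: V={1,2}, E={V}, k=2 has a vacuous right side but y^1[X]=0≠1, and for k=0 the left side always holds even if Bip H is disconnected. *)

theory Defs
  imports
    "Graph_Theory.Graph_Theory"
    "HOL-Computational_Algebra.Polynomial"
begin

text \<open>The multiset of hyperedges is a family of vertex sets: the elements of \<open>hedges H\<close> are
  names of hyperedges and \<open>hset H e\<close> is the set of vertices named by \<open>e\<close>. Different names may
  carry the same set.\<close>

record ('v, 'e) hypergraph =
  hverts :: "'v set"
  hedges :: "'e set"
  hset :: "'e \<Rightarrow> 'v set"

definition is_hypergraph :: "('v, 'e) hypergraph \<Rightarrow> bool" where
  "is_hypergraph H \<longleftrightarrow> finite (hverts H) \<and> finite (hedges H) \<and>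
     (\<forall>e\<in>hedges H. hset H e \<noteq> {} \<and> hset H e \<subseteq> hverts H)"

text \<open>As usual in \<open>Graph_Theory\<close>, an undirected graph is a digraph with a symmetric arc set.\<close>

definition Bip :: "('v, 'e) hypergraph \<Rightarrow> ('v + 'e) pair_pre_digraph" where
  "Bip H = \<lparr> pverts = Inl ` hverts H \<union> Inr ` hedges H,
     parcs = {(Inl v, Inr e) | v e. e \<in> hedges H \<and> v \<in> hset H e} \<union>
             {(Inr e, Inl v) | v e. e \<in> hedges H \<and> v \<in> hset H e} \<rparr>"

definition Bip_delete ::
  "('v, 'e) hypergraph \<Rightarrow> 'e set \<Rightarrow> ('v + 'e, ('v + 'e) \<times> ('v + 'e)) pre_digraph" where
  "Bip_delete H E' = with_proj (Bip H) \<restriction> (pverts (Bip H) - Inr ` E')"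

text \<open>Every edge of the bipartite graph has an endpoint among the hyperedges, so the edges
  incident to \<open>I\<close> are exactly those of the subgraph induced by \<open>I\<close> and its neighbours.\<close>

definition Bip_restrict ::
  "('v, 'e) hypergraph \<Rightarrow> 'e set \<Rightarrow> ('v + 'e, ('v + 'e) \<times> ('v + 'e)) pre_digraph" where
  "Bip_restrict H I = with_proj (Bip H) \<restriction> (Inl ` (\<Union>e\<in>I. hset H e) \<union> Inr ` I)"

text \<open>The strongly connected components of a symmetric digraph are its connected components.\<close>

definition num_components :: "('a, 'b) pre_digraph \<Rightarrow> nat" where
  "num_components G = card (pre_digraph.sccs G)"

definition mu :: "('v, 'e) hypergraph \<Rightarrow> 'e set \<Rightarrow> int" where
  "mu H I = (if I = {} then 0
     else int (card (\<Union>e\<in>I. hset H e)) - int (num_components (Bip_restrict H I)))"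

text \<open>A vector indexed by the hyperedges is a function vanishing outside \<open>hedges H\<close>.\<close>

definition bases :: "('v, 'e) hypergraph \<Rightarrow> ('e \<Rightarrow> int) set" where
  "bases H = {a. (\<forall>e. e \<notin> hedges H \<longrightarrow> a e = 0) \<and>
     (\<forall>I\<subseteq>hedges H. (\<Sum>e\<in>I. a e) \<le> mu H I) \<and>
     (\<Sum>e\<in>hedges H. a e) = mu H (hedges H)}"

definition unit_vec :: "'e \<Rightarrow> 'e \<Rightarrow> int" where
  "unit_vec e = (\<lambda>x. if x = e then 1 else 0)"

text \<open>The total order on \<open>hedges H\<close> is given as a reflexive relation \<open>r\<close>.\<close>

definition externally_active ::
  "('v, 'e) hypergraph \<Rightarrow> 'e rel \<Rightarrow> ('e \<Rightarrow> int) \<Rightarrow> 'e set" where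
  "externally_active H r a = {e \<in> hedges H.
     \<forall>e'\<in>hedges H. (e', e) \<in> r \<and> e' \<noteq> e \<longrightarrow>
       (\<lambda>x. a x + unit_vec e x - unit_vec e' x) \<notin> bases H}"

definition exterior_polynomial :: "('v, 'e) hypergraph \<Rightarrow> 'e rel \<Rightarrow> int poly" where
  "exterior_polynomial H r =
     (\<Sum>a\<in>bases H. monom 1 (card (hedges H) - card (externally_active H r a)))"

text \<open>The sum over \<open>bases H\<close> is a genuine finite sum.\<close>

lemma finite_bases:
  assumes "finite (hedges H)"
  shows "finite (bases H)"
proof -
  let ?E = "hedges H"
  define M where "M = (\<Sum>e\<in>?E. \<bar>mu H {e}\<bar>)"
  have up: "a e \<le> mu H {e}" if "a \<in> bases H" "e \<in> ?E" for a e
  proof -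
    have "(\<Sum>x\<in>{e}. a x) \<le> mu H {e}" using that unfolding bases_def by blast
    then show ?thesis by simp
  qed
  have "a e \<in> {mu H ?E - M..M}" if a: "a \<in> bases H" and e: "e \<in> ?E" for a e
  proof -
    have "\<bar>mu H {e}\<bar> \<le> M"
      unfolding M_def by (rule member_le_sum) (use e assms in auto)
    moreover have "(\<Sum>x\<in>?E - {e}. a x) \<le> (\<Sum>x\<in>?E - {e}. \<bar>mu H {x}\<bar>)"
      by (rule sum_mono) (use up[OF a] in force)
    moreover have "(\<Sum>x\<in>?E - {e}. \<bar>mu H {x}\<bar>) \<le> M"
      unfolding M_def by (rule sum_mono2) (use assms in auto)
    moreover have "(\<Sum>x\<in>?E. a x) = a e + (\<Sum>x\<in>?E - {e}. a x)"
      by (rule sum.remove) (use assms e in auto)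
    moreover have "(\<Sum>x\<in>?E. a x) = mu H ?E" using a by (simp add: bases_def)
    ultimately show ?thesis using up[OF a e] by simp
  qed
  then have "bases H \<subseteq> {a. \<forall>e. (e \<in> ?E \<longrightarrow> a e \<in> {mu H ?E - M..M}) \<and> (e \<notin> ?E \<longrightarrow> a e = 0)}"
    by (auto simp: bases_def)
  moreover have "finite \<dots>" by (rule finite_set_of_finite_funs) (use assms in auto)
  ultimately show ?thesis by (rule finite_subset)
qed

end

theory Submission
  imports Defs "HOL-Computational_Algebra.Polynomial_FPS"
begin

text \<open>The function \<open>mu\<close> is monotone, submodular and at most \<open>R = |V| - 1\<close>, with \<open>mu (E - E') = R\<close>
  exactly when deleting \<open>E'\<close> leaves the bipartite graph connected. Let \<open>r = mu E\<close> and call a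
  nonnegative integer vector spanning if it dominates a base. Every spanning vector \<open>c\<close> dominates
  exactly one base from which it differs only at externally active elements. If the entries of
  \<open>c\<close> are independent, with probability \<open>y (1 - y)\<^sup>j\<close> for the value \<open>j\<close>, it follows that
  \<open>c\<close> is spanning with probability \<open>(1 - y)\<^sup>r X(y)\<close>. Truncating the entries at \<open>r + 1\<close> turns
  this into the polynomial identity \<open>(1 - y)\<^sup>r X = 1 - U\<close>, where the nonspanning vector \<open>c\<close>
  contributes to \<open>U\<close> a polynomial with lowest term \<open>y\<^sup>d\<close>, \<open>d\<close> being the number of entries below
  the truncation value. Hence \<open>X\<close> agrees with \<open>(1 - y)\<close> to the power \<open>-r\<close> up to degree \<open>k\<close> iff
  deleting any \<open>k\<close> elements leaves the rank \<open>r\<close> unchanged. If \<open>r < R\<close>, both sides of the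
  equivalence fail, because the coefficient of \<open>y\<close> in \<open>X\<close> is at most \<open>r\<close>.\<close>

subsection \<open>Bases and spanning vectors of integer polymatroids\<close>

locale integer_polymatroid =
  fixes E :: "'e set" and f :: "'e set \<Rightarrow> int"
  assumes finite_ground: "finite E"
    and rank_empty: "f {} = 0"
    and rank_mono: "I \<subseteq> J \<Longrightarrow> J \<subseteq> E \<Longrightarrow> f I \<le> f J"
    and rank_submodular: "I \<subseteq> E \<Longrightarrow> J \<subseteq> E \<Longrightarrow> f (I \<union> J) + f (I \<inter> J) \<le> f I + f J"
begin

definition base_points :: "('e \<Rightarrow> int) set" where
  "base_points = {a. (\<forall>e. e \<notin> E \<longrightarrow> a e = 0) \<and> (\<forall>I\<subseteq>E. sum a I \<le> f I) \<and> sum a E = f E}"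

definition shift :: "('e \<Rightarrow> int) \<Rightarrow> 'e \<Rightarrow> 'e \<Rightarrow> 'e \<Rightarrow> int" where
  "shift a e e' = (\<lambda>x. a x + (if x = e then 1 else 0) - (if x = e' then 1 else 0))"

lemma sum_shift:
  assumes "I \<subseteq> E"
  shows "sum (shift a e e') I = sum a I + (if e \<in> I then 1 else 0) - (if e' \<in> I then 1 else 0)"
proof -
  have "finite I" using assms finite_ground finite_subset by blast
  then show ?thesis by (simp add: shift_def sum.distrib sum_subtractf)
qed

lemma base_nonneg:
  assumes a: "a \<in> base_points"
  shows "0 \<le> a e"
proof (cases "e \<in> E")
  case True
  have "sum a E = a e + sum a (E - {e})"
    using True finite_ground by (simp add: sum.remove)
  moreover have "sum a (E - {e}) \<le> f (E - {e})" "sum a E = f E"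
    using a by (auto simp: base_points_def)
  moreover have "f (E - {e}) \<le> f E" by (rule rank_mono) auto
  ultimately show ?thesis by linarith
qed (use a in \<open>simp add: base_points_def\<close>)

lemma base_le_rank:
  assumes a: "a \<in> base_points" and e: "e \<in> E"
  shows "a e \<le> f E"
proof -
  have "sum a {e} \<le> f {e}" using a e unfolding base_points_def by blast
  moreover have "f {e} \<le> f E" using e by (intro rank_mono) auto
  ultimately show ?thesis by simp
qed

lemma rank_nonneg: "I \<subseteq> E \<Longrightarrow> 0 \<le> f I"
  using rank_mono[of "{}" I] rank_empty by simp

text \<open>The sums over the union and the intersection together reach \<open>f I + f J\<close>,
  which submodularity makes an upper bound for the two ranks, so both must be tight.\<close>

lemma tight_Int:
  assumes a: "\<forall>I\<subseteq>E. sum a I \<le> f I"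
    and "I \<subseteq> E" "J \<subseteq> E" "sum a I = f I" "sum a J = f J"
  shows "sum a (I \<inter> J) = f (I \<inter> J)"
proof -
  have "finite I" "finite J" using assms finite_ground finite_subset by blast+
  then have "sum a (I \<union> J) + sum a (I \<inter> J) = f I + f J"
    using assms by (simp add: sum.union_inter)
  moreover have "sum a (I \<union> J) \<le> f (I \<union> J)" "sum a (I \<inter> J) \<le> f (I \<inter> J)"
    using assms by (auto intro: a[rule_format])
  ultimately show ?thesis using rank_submodular[OF assms(2,3)] by linarith
qed

text \<open>Sets that are tight for \<open>b\<close> and contain \<open>e\<close> are closed under
  intersection, so there is a least one, \<open>T\<close>. Any \<open>e'\<close> in \<open>T\<close>
  with \<open>a e' < b e'\<close> can give up a unit to \<open>e\<close>.\<close>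

lemma base_exchange:
  assumes a: "a \<in> base_points" and b: "b \<in> base_points" and e: "e \<in> E" "b e < a e"
  obtains e' where "e' \<in> E" "a e' < b e'" "shift b e e' \<in> base_points"
proof -
  let ?T = "{I. I \<subseteq> E \<and> e \<in> I \<and> sum b I = f I}"
  define T where "T = \<Inter>?T"
  have bI: "\<forall>I\<subseteq>E. sum b I \<le> f I" and bE: "sum b E = f E" and b0: "\<And>x. x \<notin> E \<Longrightarrow> b x = 0"
    using b by (auto simp: base_points_def)
  have ET: "E \<in> ?T" using e bE by auto
  have fin: "finite ?T" using finite_ground by simp
  have "\<Inter>S \<in> ?T" if "finite S" "S \<noteq> {}" "S \<subseteq> ?T" for S
    using that
  proof (induction rule: finite_ne_induct)
    case (insert X S)
    then have "X \<in> ?T" "\<Inter>S \<in> ?T" by auto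
    then have "X \<inter> \<Inter>S \<in> ?T" using tight_Int[OF bI, of X "\<Inter>S"] by blast
    then show ?case by simp
  qed simp
  from this[OF fin] have T: "T \<in> ?T" using ET unfolding T_def by blast
  \<comment> \<open>Otherwise \<open>a\<close> dominates \<open>b\<close> on \<open>T\<close>,
    strictly at \<open>e\<close>, so \<open>sum a T\<close> exceeds
    \<open>sum b T = f T\<close>.\<close>
  have "\<exists>e'\<in>T. a e' < b e'"
  proof (rule ccontr)
    assume "\<not> ?thesis"
    then have le: "\<forall>x\<in>T. b x \<le> a x" by force
    have finT: "finite T" using T finite_ground finite_subset by blast
    have "sum b T < sum a T" using T e le finT by (intro sum_strict_mono_ex1) auto
    moreover have "sum a T \<le> f T" using a T by (auto simp: base_points_def)
    ultimately show False using T by simp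
  qed
  then obtain e' where e': "e' \<in> T" "a e' < b e'" by blast
  have e'E: "e' \<in> E" using e' T by auto
  \<comment> \<open>Only a set containing \<open>e\<close> but not \<open>e'\<close> gains from the
    shift. It cannot be tight, as tight sets containing \<open>e\<close> include
    \<open>T\<close>.\<close>
  have "sum (shift b e e') I \<le> f I" if I: "I \<subseteq> E" for I
  proof (cases "e \<in> I \<and> sum b I = f I")
    case True
    then have "e' \<in> I" using e' I by (auto simp: T_def)
    then show ?thesis using True I by (simp add: sum_shift)
  next
    case False
    then show ?thesis using bI[rule_format, OF I] I by (auto simp: sum_shift)
  qed
  then have "shift b e e' \<in> base_points"
    using b0 bE e e'E by (auto simp: base_points_def sum_shift) (auto simp: shift_def)
  then show ?thesis using that e' e'E by blast
qed

text \<open>Greedy construction: each new element of \<open>J\<close> receives its marginal rank.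
  Extended by zero, the vector obeys all bounds on \<open>E\<close> by monotonicity.\<close>

lemma ex_base_supported:
  assumes "J \<subseteq> E" "f J = f E"
  obtains a where "a \<in> base_points" "\<And>e. e \<notin> J \<Longrightarrow> a e = 0"
proof -
  have "finite J" using assms finite_ground finite_subset by blast
  then have "\<exists>a. (\<forall>e. e \<notin> J \<longrightarrow> a e = 0) \<and> (\<forall>I\<subseteq>J. sum a I \<le> f I) \<and> sum a J = f J"
    using \<open>J \<subseteq> E\<close>
  proof (induction J)
    case empty
    then show ?case by (auto simp: rank_empty intro!: exI[of _ "\<lambda>_. 0"])
  next
    case (insert x J)
    then obtain a where a: "\<forall>e. e \<notin> J \<longrightarrow> a e = 0" "\<forall>I\<subseteq>J. sum a I \<le> f I" "sum a J = f J"
      by auto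
    let ?b = "a(x := f (insert x J) - f J)"
    have eq: "sum ?b I = sum a I" if "x \<notin> I" for I
      using that by (intro sum.cong) auto
    have "sum ?b I \<le> f I" if I: "I \<subseteq> insert x J" for I
    proof (cases "x \<in> I")
      case False
      then show ?thesis using I a eq by auto
    next
      case True
      have finI: "finite I" using I insert finite_subset by blast
      have "sum ?b I = ?b x + sum ?b (I - {x})" using True finI by (rule sum.remove[rotated])
      also have "\<dots> = f (insert x J) - f J + sum a (I - {x})" by (subst eq) auto
      also have "sum a (I - {x}) \<le> f (I - {x})" using a I by blast
      finally have "sum ?b I \<le> f (insert x J) - f J + f (I - {x})" by simp
      moreover have "f (I \<union> J) + f (I \<inter> J) \<le> f I + f J"
        using I insert by (intro rank_submodular) auto
      moreover have "I \<union> J = insert x J" "I \<inter> J = I - {x}" using I True insert by auto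
      ultimately show ?thesis by simp
    qed
    moreover have "sum ?b (insert x J) = f (insert x J)" using insert a eq by simp
    ultimately show ?case using a by (intro exI[of _ ?b]) auto
  qed
  then obtain a where a: "\<forall>e. e \<notin> J \<longrightarrow> a e = 0" "\<forall>I\<subseteq>J. sum a I \<le> f I" "sum a J = f J"
    by auto
  have eq: "sum a I = sum a (I \<inter> J)" if "I \<subseteq> E" for I
    using that a finite_ground finite_subset by (intro sum.mono_neutral_right) auto
  have "sum a I \<le> f I" if "I \<subseteq> E" for I
    using eq[OF that] a rank_mono[of "I \<inter> J" I] that by (smt (verit) Int_lower1 Int_lower2)
  moreover have "sum a E = f E" using eq[of E] a assms by (simp add: Int_absorb1)
  ultimately have "a \<in> base_points" using a assms by (auto simp: base_points_def)
  then show ?thesis using that a by blast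
qed

definition spanning :: "('e \<Rightarrow> nat) \<Rightarrow> bool" where
  "spanning c \<longleftrightarrow> (\<exists>a\<in>base_points. \<forall>e\<in>E. a e \<le> int (c e))"

text \<open>A base below \<open>c\<close> vanishes off \<open>J\<close>, so its total
  \<open>f E\<close> is at most \<open>f J\<close>.\<close>

lemma spanning_support_rank:
  assumes c: "spanning c" and J: "J \<subseteq> E" "\<And>e. e \<in> E - J \<Longrightarrow> c e = 0"
  shows "f J = f E"
proof -
  obtain a where a: "a \<in> base_points" "\<forall>e\<in>E. a e \<le> int (c e)" using c by (auto simp: spanning_def)
  have "a e = 0" if "e \<in> E - J" for e
    using base_nonneg[OF a(1), of e] J(2)[OF that] a(2) that by fastforce
  then have "sum a E = sum a J" using J finite_ground by (intro sum.mono_neutral_right) auto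
  moreover have "sum a E = f E" "sum a J \<le> f J" using a J by (auto simp: base_points_def)
  ultimately have "f E \<le> f J" by simp
  then show ?thesis using rank_mono[OF J(1)] by simp
qed

text \<open>A base supported on \<open>J\<close> has entries at most \<open>f E\<close>, hence lies
  below \<open>c\<close>.\<close>

lemma spanningI:
  assumes J: "J \<subseteq> E" "f J = f E" "\<And>e. e \<in> J \<Longrightarrow> f E \<le> int (c e)"
  shows "spanning c"
proof -
  obtain a where a: "a \<in> base_points" "\<And>e. e \<notin> J \<Longrightarrow> a e = 0"
    using ex_base_supported[OF J(1,2)] by blast
  have "a e \<le> int (c e)" if "e \<in> E" for e
    using base_le_rank[OF a(1) that] J(3)[of e] a(2)[of e] by (cases "e \<in> J") auto
  then show ?thesis using a by (auto simp: spanning_def)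
qed

end

section \<open>External activity and the partition of spanning vectors into cones\<close>

locale ordered_integer_polymatroid = integer_polymatroid E f
  for E :: "'e set" and f +
  fixes pos :: "'e \<Rightarrow> nat"
  assumes inj_pos: "inj_on pos E"
begin

definition ext_active :: "('e \<Rightarrow> int) \<Rightarrow> 'e set" where
  "ext_active a = {e \<in> E. \<forall>e'\<in>E. pos e' < pos e \<longrightarrow> shift a e e' \<notin> base_points}"

lemma ext_active_subset: "ext_active a \<subseteq> E"
  by (auto simp: ext_active_def)

text \<open>Analogue of the interval between a matroid basis and its union with its externally
  active elements. The cones of the bases partition the spanning vectors.\<close>

definition cone :: "('e \<Rightarrow> int) \<Rightarrow> ('e \<Rightarrow> nat) set" where
  "cone a = {c. (\<forall>e\<in>E. a e \<le> int (c e)) \<and> (\<forall>e\<in>E - ext_active a. a e = int (c e))}"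

text \<open>Moving a unit from a smaller to a larger element increases the potential
  \<open>\<Sum>e\<in>E. pos e * a e\<close>, so a base below \<open>c\<close> of maximal potential has \<open>c\<close> in its cone.\<close>

lemma spanning_in_cone:
  assumes "spanning c"
  obtains a where "a \<in> base_points" "c \<in> cone a"
proof -
  let ?S = "{a \<in> base_points. \<forall>e\<in>E. a e \<le> int (c e)}"
  define \<Phi> where "\<Phi> a = (\<Sum>e\<in>E. int (pos e) * a e)" for a
  \<comment> \<open>\<open>ex_has_greatest_nat\<close> needs a natural-valued measure with a strict
    bound. The potential is nonnegative on \<open>?S\<close>, so \<open>nat\<close> loses nothing
    there.\<close>
  define m where "m a = nat (\<Phi> a)" for a
  define B where "B = nat (\<Sum>e\<in>E. int (pos e) * int (c e))"
  have nn: "0 \<le> \<Phi> a" if "a \<in> ?S" for a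
    using that base_nonneg by (auto simp: \<Phi>_def intro!: sum_nonneg)
  have "m a < Suc B" if "a \<in> ?S" for a
    using that unfolding m_def B_def \<Phi>_def
    by (intro le_imp_less_Suc nat_mono sum_mono mult_left_mono) auto
  moreover obtain a0 where "a0 \<in> ?S" using assms by (auto simp: spanning_def)
  ultimately obtain a where a: "a \<in> ?S" and max: "\<And>b. b \<in> ?S \<Longrightarrow> m b \<le> m a"
    using ex_has_greatest_nat[of "\<lambda>a. a \<in> ?S" a0 m "Suc B"] by blast
  have "a e = int (c e)" if e: "e \<in> E - ext_active a" for e
  proof (rule ccontr)
    assume "a e \<noteq> int (c e)"
    then have less: "a e < int (c e)" using a e by force
    obtain e' where e': "e' \<in> E" "pos e' < pos e" "shift a e e' \<in> base_points"
      using e by (auto simp: ext_active_def)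
    have "shift a e e' \<in> ?S" using a e' less by (auto simp: shift_def)
    moreover from this max have "m (shift a e e') \<le> m a" by blast
    moreover have "\<Phi> (shift a e e') = \<Phi> a + int (pos e) - int (pos e')"
    proof -
      have "\<Phi> (shift a e e') = (\<Sum>x\<in>E. int (pos x) * a x + (if x = e then int (pos x) else 0)
          - (if x = e' then int (pos x) else 0))"
        unfolding \<Phi>_def shift_def by (intro sum.cong) (auto simp: algebra_simps)
      then show ?thesis using e e' finite_ground by (simp add: \<Phi>_def sum.distrib sum_subtractf)
    qed
    ultimately show False using nn a e' unfolding m_def by fastforce
  qed
  then show ?thesis using that a by (auto simp: cone_def)
qed

text \<open>Let \<open>e\<close> be the last element where the bases differ, with
  \<open>b e < a e\<close>, say. Exchange moves a unit in \<open>b\<close> to \<open>e\<close> from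
  an earlier element, so \<open>e\<close> is not active for \<open>b\<close> and
  \<open>b e = int (c e)\<close>, contradicting that \<open>a e\<close> is at most
  \<open>c e\<close>.\<close>

lemma cone_disjoint:
  assumes a: "a \<in> base_points" "c \<in> cone a" and b: "b \<in> base_points" "c \<in> cone b"
  shows "a = b"
proof (rule ccontr)
  assume "a \<noteq> b"
  define D where "D = {e \<in> E. a e \<noteq> b e}"
  obtain x where "a x \<noteq> b x" using \<open>a \<noteq> b\<close> by blast
  then have "x \<in> D" using a(1) b(1) by (cases "x \<in> E") (auto simp: D_def base_points_def)
  then have "D \<noteq> {}" by blast
  moreover have "finite D" using finite_ground by (simp add: D_def)
  ultimately have "Max (pos ` D) \<in> pos ` D" "\<And>x. x \<in> D \<Longrightarrow> pos x \<le> Max (pos ` D)" by auto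
  then obtain e where e: "e \<in> D" "\<And>x. x \<in> D \<Longrightarrow> pos x \<le> pos e" by (metis imageE)
  \<comment> \<open>Stated for arbitrary bases so that it also applies with \<open>a\<close> and
    \<open>b\<close> interchanged.\<close>
  have *: False if a: "a \<in> base_points" "c \<in> cone a" and b: "b \<in> base_points" "c \<in> cone b"
    and D: "D = {e \<in> E. a e \<noteq> b e}" and less: "b e < a e" for a b
  proof -
    have eE: "e \<in> E" using e D by auto
    obtain e' where e': "e' \<in> E" "a e' < b e'" "shift b e e' \<in> base_points"
      using base_exchange[OF a(1) b(1) eE less] by blast
    have "e' \<in> D" using e' D by auto
    then have "pos e' \<le> pos e" "e' \<noteq> e" using e(2) e'(2) less by auto
    then have "pos e' < pos e" using inj_pos e' eE by (metis inj_onD le_neq_implies_less)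
    then have "e \<notin> ext_active b" using e' by (auto simp: ext_active_def)
    then have "b e = int (c e)" using b eE by (auto simp: cone_def)
    then show False using less a eE by (auto simp: cone_def)
  qed
  have "a e < b e \<or> b e < a e" using e(1) by (auto simp: D_def)
  moreover have "D = {e \<in> E. b e \<noteq> a e}" by (auto simp: D_def)
  ultimately show False using *[OF a b D_def] *[OF b a] by blast
qed

lemma spanning_iff_cone: "spanning c \<longleftrightarrow> (\<exists>a\<in>base_points. c \<in> cone a)"
proof
  assume "spanning c"
  then show "\<exists>a\<in>base_points. c \<in> cone a" using spanning_in_cone by blast
qed (auto simp: spanning_def cone_def)

end


subsection \<open>Negative powers of one minus the variable\<close>

unbundle fps_syntax

text \<open>The series of (1 - X)^(-n). For \<open>n = 0\<close> the truncated subtraction is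
  harmless: the coefficient is 1 at \<open>i = 0\<close> and \<open>(i - 1) choose i = 0\<close>
  afterwards.\<close>

definition neg_binomial_fps :: "nat \<Rightarrow> int fps" where
  "neg_binomial_fps n = Abs_fps (\<lambda>i. int ((n + i - 1) choose i))"

lemma one_minus_X_power_mult_neg_binomial_fps:
  "(1 - fps_X) ^ n * neg_binomial_fps n = 1"
proof (induction n)
  case 0
  show ?case by (rule fps_ext) (auto simp: neg_binomial_fps_def binomial_eq_0)
next
  case (Suc n)
  \<comment> \<open>Coefficientwise this is Pascal's rule.\<close>
  have "(1 - fps_X) * neg_binomial_fps (Suc n) = neg_binomial_fps n"
  proof (rule fps_ext)
    fix i
    show "((1 - fps_X) * neg_binomial_fps (Suc n)) $ i = neg_binomial_fps n $ i"
    proof (cases i)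
      case 0
      then show ?thesis by (simp add: neg_binomial_fps_def)
    next
      case (Suc j)
      then show ?thesis by (simp add: neg_binomial_fps_def left_diff_distrib)
    qed
  qed
  then have "(1 - fps_X) ^ n * ((1 - fps_X) * neg_binomial_fps (Suc n)) = 1" using Suc by simp
  then show ?case by (simp only: power_Suc2 mult.assoc)
qed

lemma fps_mult_nth_eq_0:
  fixes A B :: "'a::semiring_1 fps"
  assumes "\<forall>i\<le>k. B $ i = 0" "i \<le> k"
  shows "(A * B) $ i = 0"
  using assms by (auto simp: fps_mult_nth intro!: sum.neutral)

text \<open>With P, U, G the series of \<open>p\<close>, \<open>u\<close> and (1 - X)^(-n), the
  identity reads G - P = G U and also U = (1 - X)^n (G - P). Each of U and G - P is a multiple of
  the other, so they vanish up to the same degree.\<close>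

lemma
  fixes p u :: "int poly"
  assumes id: "[:1, -1:] ^ n * p = 1 - u"
  shows coeffs_neg_binomial_iff:
      "(\<forall>i\<le>k. coeff p i = int ((n + i - 1) choose i)) \<longleftrightarrow> (\<forall>i\<le>k. coeff u i = 0)"
    and coeff_1_neg_binomial: "coeff u 0 = 0 \<Longrightarrow> coeff p 1 = int n - coeff u 1"
proof -
  let ?G = "neg_binomial_fps n" and ?P = "fps_of_poly p" and ?U = "fps_of_poly u"
  have X: "fps_of_poly [:1, -1:] = (1 - fps_X :: int fps)"
    by (simp add: fps_of_poly_pCons)
  have "(1 - fps_X) ^ n * ?P = 1 - ?U"
    using arg_cong[OF id, of fps_of_poly]
    by (simp add: fps_of_poly_mult fps_of_poly_power fps_of_poly_diff X)
  then have "?G * ((1 - fps_X) ^ n * ?P) = ?G * (1 - ?U)" by simp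
  moreover have "?G * ((1 - fps_X) ^ n * ?P) = (1 - fps_X) ^ n * ?G * ?P"
    by (simp only: mult_ac)
  ultimately have P: "?P = ?G - ?G * ?U"
    by (simp add: one_minus_X_power_mult_neg_binomial_fps right_diff_distrib)
  then have "(1 - fps_X) ^ n * (?G - ?P) = (1 - fps_X) ^ n * ?G * ?U" by (simp add: mult.assoc)
  then have U: "?U = (1 - fps_X) ^ n * (?G - ?P)"
    by (simp add: one_minus_X_power_mult_neg_binomial_fps)
  have diff: "?G - ?P = ?G * ?U" using P by simp
  show "(\<forall>i\<le>k. coeff p i = int ((n + i - 1) choose i)) \<longleftrightarrow> (\<forall>i\<le>k. coeff u i = 0)"
  proof
    assume "\<forall>i\<le>k. coeff p i = int ((n + i - 1) choose i)"
    then have "\<forall>i\<le>k. (?G - ?P) $ i = 0" by (simp add: neg_binomial_fps_def)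
    then have "?U $ i = 0" if "i \<le> k" for i using that fps_mult_nth_eq_0 U by metis
    then show "\<forall>i\<le>k. coeff u i = 0" by simp
  next
    assume "\<forall>i\<le>k. coeff u i = 0"
    then have "\<forall>i\<le>k. ?U $ i = 0" by simp
    then have "(?G - ?P) $ i = 0" if "i \<le> k" for i using that fps_mult_nth_eq_0 diff by metis
    then show "\<forall>i\<le>k. coeff p i = int ((n + i - 1) choose i)" by (simp add: neg_binomial_fps_def)
  qed
  assume u0: "coeff u 0 = 0"
  have "?P $ 1 = (?G - ?G * ?U) $ 1" using P by simp
  then show "coeff p 1 = int n - coeff u 1"
    using u0 by (simp add: fps_mult_nth_1 neg_binomial_fps_def)
qed

subsection \<open>Low coefficients of the exterior polynomial\<close>

context ordered_integer_polymatroid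
begin

text \<open>Entries of bases are at most \<open>f E\<close>, so the value \<open>cap\<close>, which
  stands for all larger values too, is never an exact entry of a base.\<close>

definition cap :: nat where
  "cap = Suc (nat (f E))"

text \<open>The truncated geometric law as polynomials in y: \<open>[:0, 1:]\<close> is y,
  \<open>[:1, -1:]\<close> is 1 - y, and the value \<open>cap\<close> carries the whole
  tail.\<close>

definition wt :: "nat \<Rightarrow> int poly" where
  "wt j = (if j < cap then [:0, 1:] * [:1, -1:] ^ j else [:1, -1:] ^ cap)"

text \<open>Tail probabilities, by downward induction from \<open>cap\<close> with y (1 - y)^n + (1
  - y)^(n+1) = (1 - y)^n.\<close>

lemma sum_wt:
  assumes "n \<le> cap"
  shows "(\<Sum>j\<in>{n..cap}. wt j) = [:1, -1:] ^ n"
  using assms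
proof (induction n rule: inc_induct)
  case (step n)
  then have "(\<Sum>j\<in>{n..cap}. wt j) = wt n + [:1, -1:] ^ Suc n"
    by (simp add: sum.atLeast_Suc_atMost del: power_Suc)
  also have "\<dots> = ([:0, 1:] + [:1, -1:]) * [:1, -1:] ^ n"
    using step by (simp add: wt_def algebra_simps)
  also have "[:0, 1:] + [:1, -1:] = (1 :: int poly)" by (simp add: one_pCons)
  finally show ?case by simp
qed (simp add: wt_def)

definition weight :: "('e \<Rightarrow> nat) \<Rightarrow> int poly" where
  "weight c = (\<Prod>e\<in>E. wt (c e))"

definition box :: "('e \<Rightarrow> nat) set" where
  "box = PiE E (\<lambda>_. {..cap})"

lemma finite_box: "finite box"
  unfolding box_def using finite_ground by (intro finite_PiE) auto

lemma sum_weight_box: "sum weight box = 1"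
proof -
  have "sum weight box = (\<Prod>e\<in>E. \<Sum>j\<in>{..cap}. wt j)"
    unfolding weight_def box_def using finite_ground by (subst prod_sum_PiE) auto
  then show ?thesis using sum_wt[of 0] by (simp add: atLeast0AtMost)
qed

lemma nat_base_less_cap:
  assumes "a \<in> base_points" "e \<in> E"
  shows "nat (a e) < cap"
  using base_le_rank[OF assms] by (simp add: cap_def nat_mono less_Suc_eq_le)

text \<open>Inside the box a cone is a product. An active element contributes a tail (1 - y)^(a e),
  any other the single weight y (1 - y)^(a e), and the exponents \<open>a e\<close> add up to
  \<open>f E\<close>.\<close>

lemma sum_weight_cone:
  assumes a: "a \<in> base_points"
  shows "sum weight (cone a \<inter> box) =
    [:1, -1:] ^ nat (f E) * monom 1 (card E - card (ext_active a))"
proof -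
  let ?X = "ext_active a"
  let ?S = "\<lambda>e. if e \<in> ?X then {nat (a e)..cap} else {nat (a e)}"
  have less: "nat (a e) < cap" if "e \<in> E" for e
    using nat_base_less_cap[OF a that] .
  have "cone a \<inter> box = PiE E ?S"
  proof (intro equalityI subsetI)
    fix c assume "c \<in> cone a \<inter> box"
    then show "c \<in> PiE E ?S"
      by (auto simp: cone_def box_def PiE_iff nat_le_iff)
  next
    fix c assume c: "c \<in> PiE E ?S"
    have "c e \<in> ?S e" if "e \<in> E" for e using c that by (auto simp: PiE_iff)
    then have "a e \<le> int (c e) \<and> c e \<le> cap \<and> (e \<notin> ?X \<longrightarrow> a e = int (c e))" if "e \<in> E" for e
      using that less[OF that] base_nonneg[OF a, of e] by (force split: if_splits)
    then show "c \<in> cone a \<inter> box" using c by (auto simp: cone_def box_def PiE_iff)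
  qed
  then have "sum weight (cone a \<inter> box) = (\<Prod>e\<in>E. \<Sum>j\<in>?S e. wt j)"
    unfolding weight_def using finite_ground by (subst prod_sum_PiE) auto
  also have "\<dots> = (\<Prod>e\<in>E. [:1, -1:] ^ nat (a e) * (if e \<in> E - ?X then [:0, 1:] else 1))"
  proof (rule prod.cong)
    fix e assume "e \<in> E"
    then show "(\<Sum>j\<in>?S e. wt j) = [:1, -1:] ^ nat (a e) * (if e \<in> E - ?X then [:0, 1:] else 1)"
      using less[of e] by (cases "e \<in> ?X") (simp add: sum_wt, simp add: wt_def)
  qed simp
  also have "\<dots> = [:1, -1:] ^ (\<Sum>e\<in>E. nat (a e)) * [:0, 1:] ^ card (E - ?X)"
    using finite_ground
    by (simp add: prod.distrib power_sum prod.If_cases Int_def set_diff_eq conj_commute)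
  also have "(\<Sum>e\<in>E. nat (a e)) = nat (f E)"
  proof -
    have "int (\<Sum>e\<in>E. nat (a e)) = sum a E" using base_nonneg[OF a] by simp
    also have "\<dots> = f E" using a by (simp add: base_points_def)
    finally show ?thesis by linarith
  qed
  also have "card (E - ?X) = card E - card ?X"
    using ext_active_subset finite_ground finite_subset by (intro card_Diff_subset) blast+
  finally show ?thesis by (simp add: monom_altdef)
qed

lemma finite_base_points: "finite base_points"
proof -
  have "finite {a. \<forall>e. (e \<in> E \<longrightarrow> a e \<in> {0..f E}) \<and> (e \<notin> E \<longrightarrow> a e = 0)}"
    using finite_ground by (intro finite_set_of_finite_funs) auto
  then show ?thesis
    by (rule rev_finite_subset) (use base_nonneg base_le_rank in \<open>auto simp: base_points_def\<close>)
qed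

definition ext_poly :: "int poly" where
  "ext_poly = (\<Sum>a\<in>base_points. monom 1 (card E - card (ext_active a)))"

definition nonspanning :: "('e \<Rightarrow> nat) set" where
  "nonspanning = {c \<in> box. \<not> spanning c}"

text \<open>The box has total weight 1, and the cones partition its spanning vectors.\<close>

lemma ext_poly_identity:
  "[:1, -1:] ^ nat (f E) * ext_poly = 1 - sum weight nonspanning"
proof -
  have "[:1, -1:] ^ nat (f E) * ext_poly = (\<Sum>a\<in>base_points. sum weight (cone a \<inter> box))"
    by (simp add: ext_poly_def sum_weight_cone sum_distrib_left)
  also have "\<dots> = sum weight (\<Union>a\<in>base_points. cone a \<inter> box)"
    using finite_base_points finite_box cone_disjoint by (intro sum.UNION_disjoint[symmetric]) auto
  also have "(\<Union>a\<in>base_points. cone a \<inter> box) = box - nonspanning"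
    by (auto simp: nonspanning_def spanning_iff_cone)
  also have "sum weight \<dots> = 1 - sum weight nonspanning"
    using finite_box sum_weight_box by (subst sum_diff) (auto simp: nonspanning_def)
  finally show ?thesis .
qed

section \<open>Lowest terms of the nonspanning contribution\<close>

definition deficit :: "('e \<Rightarrow> nat) \<Rightarrow> nat" where
  "deficit c = card {e \<in> E. c e < cap}"

text \<open>Each entry below \<open>cap\<close> supplies one factor y, a capped entry none. All
  remaining factors are powers of 1 - y, with constant term 1.\<close>

lemma weight_factor:
  obtains n where "weight c = monom 1 (deficit c) * [:1, -1:] ^ n"
proof
  have "weight c = (\<Prod>e\<in>E. (if e \<in> {e \<in> E. c e < cap} then [:0, 1:] else 1) * [:1, -1:] ^ min (c e) cap)"
    unfolding weight_def wt_def by (intro prod.cong) (auto simp: min_def)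
  also have "\<dots> = [:0, 1:] ^ deficit c * [:1, -1:] ^ (\<Sum>e\<in>E. min (c e) cap)"
    using finite_ground unfolding deficit_def
    by (simp add: prod.distrib power_sum prod.If_cases Collect_conj_eq Int_absorb1)
  finally show "weight c = monom 1 (deficit c) * [:1, -1:] ^ (\<Sum>e\<in>E. min (c e) cap)"
    by (simp add: monom_altdef)
qed

lemma coeff_weight:
  assumes "i \<le> deficit c"
  shows "coeff (weight c) i = (if i = deficit c then 1 else 0)"
proof -
  obtain n where n: "weight c = monom 1 (deficit c) * [:1, -1:] ^ n" by (rule weight_factor)
  show ?thesis using assms by (simp add: n coeff_monom_mult coeff_0_power)
qed

text \<open>Lowest terms cannot cancel: at the minimal deficit every weight has coefficient 0 or 1,
  and a vector attaining the minimum has 1.\<close>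

lemma nonspanning_coeffs_eq_0_iff:
  "(\<forall>i\<le>k. coeff (sum weight nonspanning) i = 0) \<longleftrightarrow> (\<forall>c\<in>nonspanning. k < deficit c)"
proof
  assume "\<forall>c\<in>nonspanning. k < deficit c"
  then show "\<forall>i\<le>k. coeff (sum weight nonspanning) i = 0"
    by (auto simp: coeff_sum coeff_weight intro!: sum.neutral)
next
  assume 0: "\<forall>i\<le>k. coeff (sum weight nonspanning) i = 0"
  show "\<forall>c\<in>nonspanning. k < deficit c"
  proof (rule ccontr)
    assume "\<not> ?thesis"
    then obtain c0 where "c0 \<in> nonspanning" "deficit c0 \<le> k" by force
    then obtain c where c: "c \<in> nonspanning" "deficit c \<le> k"
      and min: "\<And>d. d \<in> nonspanning \<Longrightarrow> deficit c \<le> deficit d"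
      using ex_has_least_nat[of "\<lambda>c. c \<in> nonspanning" c0 deficit] le_trans by metis
    have "0 < (\<Sum>d\<in>nonspanning. coeff (weight d) (deficit c))"
      using c finite_box by (intro sum_pos2[of _ c]) (auto simp: nonspanning_def coeff_weight min)
    then show False using 0 c by (simp add: coeff_sum)
  qed
qed

lemma deficit_nonspanning_iff:
  assumes "k \<le> card E"
  shows "(\<forall>c\<in>nonspanning. k < deficit c) \<longleftrightarrow> (\<forall>D\<subseteq>E. card D = k \<longrightarrow> f (E - D) = f E)"
proof
  assume *: "\<forall>c\<in>nonspanning. k < deficit c"
  show "\<forall>D\<subseteq>E. card D = k \<longrightarrow> f (E - D) = f E"
  proof (intro allI impI)
    fix D assume D: "D \<subseteq> E" "card D = k"
    \<comment> \<open>The largest vector of the box that vanishes on \<open>D\<close>.\<close>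
    define c where "c = restrict (\<lambda>e. if e \<in> D then 0 else cap) E"
    have "{e \<in> E. c e < cap} = D" using D by (auto simp: c_def cap_def)
    then have "deficit c = k" using D by (simp add: deficit_def)
    moreover have "c \<in> box" by (auto simp: c_def box_def)
    ultimately have "spanning c" using * by (auto simp: nonspanning_def)
    then show "f (E - D) = f E" by (rule spanning_support_rank) (use D in \<open>auto simp: c_def\<close>)
  qed
next
  assume *: "\<forall>D\<subseteq>E. card D = k \<longrightarrow> f (E - D) = f E"
  show "\<forall>c\<in>nonspanning. k < deficit c"
  proof (rule ballI, rule ccontr)
    fix c assume c: "c \<in> nonspanning" "\<not> k < deficit c"
    let ?D = "{e \<in> E. c e < cap}"
    have "card ?D \<le> k" using c by (simp add: deficit_def)
    \<comment> \<open>The uncapped entries may be fewer than \<open>k\<close>;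
      \<open>k \<le> card E\<close> leaves room to enlarge their set to size exactly
      \<open>k\<close>.\<close>
    then obtain D where D: "?D \<subseteq> D" "D \<subseteq> E" "card D = k"
      using exists_subset_between[of ?D k E] assms finite_ground by auto
    have "spanning c"
    proof (rule spanningI)
      show "f (E - D) = f E" using * D by blast
      fix e assume "e \<in> E - D"
      then have "cap \<le> c e" using D by force
      then show "f E \<le> int (c e)" by (simp add: cap_def)
    qed auto
    then show False using c by (simp add: nonspanning_def)
  qed
qed

theorem ext_poly_coeffs_iff:
  assumes "k \<le> card E"
  shows "(\<forall>i\<le>k. coeff ext_poly i = int ((nat (f E) + i - 1) choose i))
    \<longleftrightarrow> (\<forall>D\<subseteq>E. card D = k \<longrightarrow> f (E - D) = f E)"
  using coeffs_neg_binomial_iff[OF ext_poly_identity] nonspanning_coeffs_eq_0_iff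
    deficit_nonspanning_iff[OF assms] by simp

text \<open>Deleting nothing keeps the rank, so nonspanning vectors have positive deficit. Their
  weights then have no constant term and a nonnegative coefficient of y, which is subtracted from
  \<open>f E\<close>.\<close>

lemma coeff_1_ext_poly_le: "coeff ext_poly 1 \<le> f E"
proof -
  have pos: "\<forall>c\<in>nonspanning. 0 < deficit c"
    by (subst deficit_nonspanning_iff) (use finite_ground finite_subset in \<open>auto simp: card_eq_0_iff\<close>)
  then have "coeff (sum weight nonspanning) 0 = 0" using nonspanning_coeffs_eq_0_iff[of 0] by simp
  then have "coeff ext_poly 1 = int (nat (f E)) - coeff (sum weight nonspanning) 1"
    by (rule coeff_1_neg_binomial[OF ext_poly_identity])
  moreover have "0 \<le> coeff (sum weight nonspanning) 1"
    using pos by (auto simp: coeff_sum coeff_weight Suc_le_eq intro!: sum_nonneg)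
  ultimately show ?thesis using rank_nonneg[of E] by simp
qed

end

subsection \<open>The rank function of a hypergraph\<close>

text \<open>In a symmetric digraph these are the unions of components. Their number is 2 to the
  number of components, which turns rank inequalities into counting.\<close>

definition adj_closed_sets :: "('a, 'b) pre_digraph \<Rightarrow> 'a set set" where
  "adj_closed_sets G = {A. A \<subseteq> verts G \<and> (\<forall>x\<in>A. \<forall>y. x \<rightarrow>\<^bsub>G\<^esub> y \<longrightarrow> y \<in> A)}"

lemma adj_closed_sets_reachable:
  assumes "A \<in> adj_closed_sets G" "x \<rightarrow>\<^sup>*\<^bsub>G\<^esub> y" "x \<in> A"
  shows "y \<in> A"
proof -
  have "(x, y) \<in> (arcs_ends G)\<^sup>*" using assms(2) by (rule reachable_rtranclI)
  then show ?thesis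
    by (induction rule: rtrancl_induct) (use assms in \<open>auto simp: adj_closed_sets_def\<close>)
qed

context pseudo_graph
begin

lemma card_adj_closed_sets: "card (adj_closed_sets G) = 2 ^ num_components G"
proof -
  have inj: "inj_on (\<lambda>S. \<Union>S) (Pow sccs_verts)"
  proof (rule inj_onI)
    have "S \<subseteq> T" if ST: "S \<subseteq> sccs_verts" "T \<subseteq> sccs_verts" "\<Union>S = \<Union>T" for S T
    proof
      fix X assume "X \<in> S"
      then have "X \<noteq> {}" using ST by (auto simp: sccs_verts_def)
      then obtain x where "x \<in> X" by blast
      moreover from this obtain Y where "Y \<in> T" "x \<in> Y" using ST(3) \<open>X \<in> S\<close> by blast
      ultimately have "X \<inter> Y \<noteq> {}" by blast
      then show "X \<in> T" using sccs_verts_disjoint[of X Y] ST \<open>X \<in> S\<close> \<open>Y \<in> T\<close> by blast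
    qed
    then show "S = T" if "S \<in> Pow sccs_verts" "T \<in> Pow sccs_verts" "\<Union>S = \<Union>T" for S T
      using that by (metis PowD subset_antisym)
  qed
  have "(\<lambda>S. \<Union>S) ` Pow sccs_verts = adj_closed_sets G"
  proof (intro equalityI subsetI)
    fix A assume "A \<in> (\<lambda>S. \<Union>S) ` Pow sccs_verts"
    then obtain S where S: "S \<subseteq> sccs_verts" "A = \<Union>S" by blast
    have "y \<in> A" if xy: "x \<in> A" "x \<rightarrow> y" for x y
    proof -
      obtain X where X: "X \<in> S" "x \<in> X" using xy S by blast
      have "x \<rightarrow>\<^sup>* y" "y \<rightarrow>\<^sup>* x"
        using xy(2) arcs_ends_symmetric[OF sym_arcs xy(2)] by (simp_all only: reachable_adjI)
      moreover have "X \<in> sccs_verts" using X(1) S(1) by (rule subsetD[rotated])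
      ultimately have "y \<in> X"
        using X(2) unfolding in_sccs_verts_conv_reachable by meson
      then show ?thesis using X S by blast
    qed
    moreover have "A \<subseteq> verts G" using S sccs_verts_subsets by blast
    ultimately show "A \<in> adj_closed_sets G" by (auto simp: adj_closed_sets_def)
  next
    fix A assume A: "A \<in> adj_closed_sets G"
    then have sub: "A \<subseteq> verts G" by (simp add: adj_closed_sets_def)
    have "scc_of x \<subseteq> A" if "x \<in> A" for x
      using adj_closed_sets_reachable[OF A] that by (auto simp: scc_of_def)
    then have "A = \<Union>(scc_of ` A)" using in_scc_of_self sub by blast
    moreover have "scc_of ` A \<subseteq> sccs_verts" using scc_of_in_sccs_verts sub by blast
    ultimately show "A \<in> (\<lambda>S. \<Union>S) ` Pow sccs_verts" by blast
  qed
  then have "card (adj_closed_sets G) = card (Pow sccs_verts)" using inj card_image by metis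
  then show ?thesis by (simp add: card_Pow finite_sccs_verts num_components_def card_sccs_verts)
qed

lemma connected_iff_card_adj_closed_sets: "connected G \<longleftrightarrow> card (adj_closed_sets G) = 2"
proof -
  have fin: "finite (adj_closed_sets G)"
    by (rule finite_subset[of _ "Pow (verts G)"]) (auto simp: adj_closed_sets_def)
  have sub: "{{}, verts G} \<subseteq> adj_closed_sets G"
    by (auto simp: adj_closed_sets_def adj_in_verts)
  have conn: "connected G \<longleftrightarrow> verts G \<noteq> {} \<and> (\<forall>u\<in>verts G. \<forall>v\<in>verts G. u \<rightarrow>\<^sup>* v)"
    using reachable_mk_symmetric_eq[OF sym_arcs]
    by (simp add: connected_def strongly_connected_def)
  show ?thesis
  proof
    assume "connected G"
    then have ne: "verts G \<noteq> {}" and reach: "\<And>u v. u \<in> verts G \<Longrightarrow> v \<in> verts G \<Longrightarrow> u \<rightarrow>\<^sup>* v"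
      unfolding conn by blast+
    have "A = {} \<or> A = verts G" if A: "A \<in> adj_closed_sets G" for A
    proof -
      have "A \<subseteq> verts G" using A by (simp add: adj_closed_sets_def)
      moreover have "v \<in> A" if "x \<in> A" "v \<in> verts G" for x v
        using adj_closed_sets_reachable[OF A reach[of x v]] that calculation by blast
      ultimately show ?thesis by blast
    qed
    then have "adj_closed_sets G = {{}, verts G}" using sub by blast
    with ne show "card (adj_closed_sets G) = 2" by simp
  next
    assume 2: "card (adj_closed_sets G) = 2"
    have ne: "verts G \<noteq> {}"
    proof
      assume "verts G = {}"
      then have "adj_closed_sets G = {{}}" by (auto simp: adj_closed_sets_def)
      then show False using 2 by simp
    qed
    then have "card {{}, verts G} = 2" by simp
    then have eq: "adj_closed_sets G = {{}, verts G}" using sub fin 2 card_subset_eq by metis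
    have "u \<rightarrow>\<^sup>* v" if uv: "u \<in> verts G" "v \<in> verts G" for u v
    proof -
      \<comment> \<open>This closed set contains \<open>u\<close>, so it must be all of
        \<open>verts G\<close>.\<close>
      have "{w. u \<rightarrow>\<^sup>* w} \<in> adj_closed_sets G"
        using reachable_in_verts reachable_adj_trans by (auto simp: adj_closed_sets_def)
      then show ?thesis using eq uv by auto
    qed
    then show "connected G" using ne conn by simp
  qed
qed

end

text \<open>When \<open>U\<close> contains the hyperedges of \<open>I\<close>, these are the vertex
  parts of the adjacency-closed sets. A fixed \<open>U\<close> lets families for different
  \<open>I\<close> be compared inside one power set.\<close>

definition saturated_sets :: "('v, 'e) hypergraph \<Rightarrow> 'v set \<Rightarrow> 'e set \<Rightarrow> 'v set set" where
  "saturated_sets H U I = {A. A \<subseteq> U \<and> (\<forall>e\<in>I. hset H e \<subseteq> A \<or> hset H e \<inter> A = {})}"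

lemma finite_saturated_sets: "finite U \<Longrightarrow> finite (saturated_sets H U I)"
  by (rule finite_subset[of _ "Pow U"]) (auto simp: saturated_sets_def)

text \<open>Saturated sets form a vector space over the field with two elements under symmetric
  difference; the
  inequality amounts to the dimension formula for a sum of subspaces.\<close>

lemma card_saturated_sets_submodular:
  fixes H :: "('v, 'e) hypergraph"
  assumes "finite U"
  shows "card (saturated_sets H U I) * card (saturated_sets H U J)
    \<le> card (saturated_sets H U (I \<inter> J)) * card (saturated_sets H U (I \<union> J))"
proof -
  let ?S = "saturated_sets H U"
  define d :: "'v set \<Rightarrow> 'v set \<Rightarrow> 'v set" where "d A B = (A - B) \<union> (B - A)" for A B
  have d_sat: "d A B \<in> ?S K" if "A \<in> ?S K" "B \<in> ?S K" for A B K
    using that unfolding saturated_sets_def d_def by blast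
  have d_cancel: "d A (d A B) = B" for A B by (auto simp: d_def)
  have fin: "finite (?S K)" for K using assms by (rule finite_saturated_sets)
  have d_cancel': "d B (d A B) = A" for A B by (auto simp: d_def)
  have d_swap: "d A A' = d B B'" if "d A B = d A' B'" for A A' B B'
  proof (rule set_eqI)
    fix x
    have "x \<in> d A B \<longleftrightarrow> x \<in> d A' B'" using that by simp
    then show "x \<in> d A A' \<longleftrightarrow> x \<in> d B B'" unfolding d_def by blast
  qed
  \<comment> \<open>Each symmetric difference D of members of the two families gets one chosen
    representing pair. The map \<open>g\<close> records D and the offset of the first component from
    that choice, which determines the pair.\<close>
  define P where "P D p \<longleftrightarrow> p \<in> ?S I \<times> ?S J \<and> d (fst p) (snd p) = D" for D p
  define rep where "rep D = (SOME p. P D p)" for D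
  define g where "g p = (d (fst p) (snd p), d (fst p) (fst (rep (d (fst p) (snd p)))))" for p
  have "inj_on g (?S I \<times> ?S J)"
  proof (rule inj_onI)
    fix p q assume "g p = g q"
    then have g: "d (fst p) (snd p) = d (fst q) (snd q) \<and>
        d (fst p) (fst (rep (d (fst p) (snd p)))) = d (fst q) (fst (rep (d (fst q) (snd q))))"
      unfolding g_def prod.inject .
    define R where "R = fst (rep (d (fst q) (snd q)))"
    have "d (fst p) R = d (fst q) R"
      using conjunct2[OF g] unfolding conjunct1[OF g] R_def .
    then have "d R (d (fst p) R) = d R (d (fst q) R)" by (rule arg_cong)
    then have fst: "fst p = fst q" unfolding d_cancel' .
    have "d (fst q) (snd p) = d (fst q) (snd q)" using conjunct1[OF g] unfolding fst .
    then have "d (fst q) (d (fst q) (snd p)) = d (fst q) (d (fst q) (snd q))" by (rule arg_cong)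
    then have "snd p = snd q" unfolding d_cancel .
    with fst show "p = q" by (rule prod_eqI)
  qed
  moreover have "g ` (?S I \<times> ?S J) \<subseteq> ?S (I \<inter> J) \<times> ?S (I \<union> J)"
  proof (rule image_subsetI)
    fix p assume p: "p \<in> ?S I \<times> ?S J"
    define D where "D = d (fst p) (snd p)"
    have "P D p" using p by (simp add: P_def D_def)
    then have rep: "P D (rep D)" unfolding rep_def by (rule someI)
    have "?S I \<subseteq> ?S (I \<inter> J)" "?S J \<subseteq> ?S (I \<inter> J)"
      unfolding saturated_sets_def by blast+
    then have memD: "fst p \<in> ?S (I \<inter> J)" "snd p \<in> ?S (I \<inter> J)"
      using p by auto
    \<comment> \<open>Two representations of D differ by the same set in both components; this set
      is therefore saturated for \<open>I\<close> and for \<open>J\<close>.\<close>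
    have "d (fst p) (fst (rep D)) = d (snd p) (snd (rep D))"
    proof (rule d_swap)
      show "d (fst p) (snd p) = d (fst (rep D)) (snd (rep D))" using rep by (simp add: P_def D_def)
    qed
    moreover have "d (fst p) (fst (rep D)) \<in> ?S I" "d (snd p) (snd (rep D)) \<in> ?S J"
      using p rep by (auto simp: P_def intro!: d_sat)
    ultimately have "d (fst p) (fst (rep D)) \<in> ?S (I \<union> J)"
      unfolding saturated_sets_def by auto
    then show "g p \<in> ?S (I \<inter> J) \<times> ?S (I \<union> J)"
      using d_sat[OF memD] by (simp add: g_def D_def)
  qed
  ultimately have "card (?S I \<times> ?S J) \<le> card (?S (I \<inter> J) \<times> ?S (I \<union> J))"
    by (rule card_inj_on_le) (simp add: fin)
  then show ?thesis by (simp add: card_cartesian_product)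
qed

section \<open>The rank as codimension of the space of saturated sets\<close>

locale finite_hypergraph =
  fixes H :: "('v, 'e) hypergraph"
  assumes is_hypergraph: "is_hypergraph H"
begin

lemma finite_verts: "finite (hverts H)" and finite_edges: "finite (hedges H)"
  and edge_nonempty: "e \<in> hedges H \<Longrightarrow> hset H e \<noteq> {}"
  and edge_subset: "e \<in> hedges H \<Longrightarrow> hset H e \<subseteq> hverts H"
  using is_hypergraph by (auto simp: is_hypergraph_def)

context
  fixes U I
  assumes U: "U \<subseteq> hverts H" and I: "I \<subseteq> hedges H" and IU: "(\<Union>e\<in>I. hset H e) \<subseteq> U"
begin

lemma dominates_Bip_induced:
  "x \<rightarrow>\<^bsub>with_proj (Bip H) \<restriction> (Inl ` U \<union> Inr ` I)\<^esub> y \<longleftrightarrow>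
    (\<exists>v e. e \<in> I \<and> v \<in> hset H e \<and> (x = Inl v \<and> y = Inr e \<or> x = Inr e \<and> y = Inl v))"
  using U I IU unfolding arcs_ends_conv by (auto simp: Bip_def image_iff)

lemma pseudo_graph_Bip_induced: "pseudo_graph (with_proj (Bip H) \<restriction> (Inl ` U \<union> Inr ` I))"
    (is "pseudo_graph ?G")
proof
  have fin: "finite U" "finite I" using U I finite_verts finite_edges finite_subset by blast+
  show "finite (verts ?G)" using fin by simp
  have "arcs ?G \<subseteq> verts ?G \<times> verts ?G" by auto
  then show "finite (arcs ?G)" by (rule finite_subset) (use fin in simp)
  show "Digraph.symmetric ?G"
    unfolding symmetric_def by (rule symI) (simp only: dominates_Bip_induced, blast)
qed auto

lemma bij_betw_adj_closed_saturated:
  "bij_betw (\<lambda>A. Inl -` A)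
     (adj_closed_sets (with_proj (Bip H) \<restriction> (Inl ` U \<union> Inr ` I))) (saturated_sets H U I)"
    (is "bij_betw _ (adj_closed_sets ?G) _")
proof (rule bij_betw_byWitness)
  let ?g = "\<lambda>A. Inl ` A \<union> Inr ` {e \<in> I. hset H e \<subseteq> A}"
  have closed: "(Inl v \<in> A \<longleftrightarrow> Inr e \<in> A)"
    if "A \<in> adj_closed_sets ?G" "e \<in> I" "v \<in> hset H e" for A v e
    using that unfolding adj_closed_sets_def dominates_Bip_induced by blast
  show "\<forall>A\<in>adj_closed_sets ?G. ?g (Inl -` A) = A"
  proof
    fix A assume A: "A \<in> adj_closed_sets ?G"
    have sub: "A \<subseteq> Inl ` U \<union> Inr ` I" using A by (auto simp: adj_closed_sets_def)
    show "?g (Inl -` A) = A"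
    proof (rule set_eqI)
      fix x
      show "x \<in> ?g (Inl -` A) \<longleftrightarrow> x \<in> A"
      proof (cases x)
        case (Inl v)
        then show ?thesis by auto
      next
        case (Inr e)
        show ?thesis
        proof (cases "e \<in> I")
          case True
          \<comment> \<open>An empty hyperedge would be an isolated node, invisible in the vertex
            part; nonemptiness makes the vertex part determine the closed set.\<close>
          then obtain v where "v \<in> hset H e" using edge_nonempty I by blast
          then have "hset H e \<subseteq> Inl -` A \<longleftrightarrow> Inr e \<in> A" using closed[OF A True] by auto
          then show ?thesis using Inr True by auto
        next
          case False
          then show ?thesis using Inr sub by auto
        qed
      qed
    qed
  qed
  show "\<forall>A\<in>saturated_sets H U I. Inl -` ?g A = A" by auto
  show "(\<lambda>A. Inl -` A) ` adj_closed_sets ?G \<subseteq> saturated_sets H U I"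
  proof (rule image_subsetI)
    fix A assume A: "A \<in> adj_closed_sets ?G"
    have "A \<subseteq> Inl ` U \<union> Inr ` I" using A by (auto simp: adj_closed_sets_def)
    then show "Inl -` A \<in> saturated_sets H U I"
      using closed[OF A] by (auto simp: saturated_sets_def)
  qed
  show "?g ` saturated_sets H U I \<subseteq> adj_closed_sets ?G"
  proof (rule image_subsetI)
    fix A assume A: "A \<in> saturated_sets H U I"
    show "?g A \<in> adj_closed_sets ?G"
      using A unfolding adj_closed_sets_def dominates_Bip_induced
      by (auto simp: saturated_sets_def)
  qed
qed

lemma card_saturated_sets:
  "card (saturated_sets H U I) = 2 ^ num_components (with_proj (Bip H) \<restriction> (Inl ` U \<union> Inr ` I))"
  using bij_betw_same_card[OF bij_betw_adj_closed_saturated]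
    pseudo_graph.card_adj_closed_sets[OF pseudo_graph_Bip_induced] by simp

lemma connected_iff_card_saturated_sets:
  "connected (with_proj (Bip H) \<restriction> (Inl ` U \<union> Inr ` I)) \<longleftrightarrow> card (saturated_sets H U I) = 2"
  using bij_betw_same_card[OF bij_betw_adj_closed_saturated]
    pseudo_graph.connected_iff_card_adj_closed_sets[OF pseudo_graph_Bip_induced] by simp

end

text \<open>Vertices outside \<open>W\<close> lie in no hyperedge of \<open>I\<close>, so each can
  be included or omitted freely.\<close>

lemma card_saturated_sets_extend:
  assumes I: "I \<subseteq> hedges H"
  defines "W \<equiv> \<Union>e\<in>I. hset H e"
  shows "card (saturated_sets H (hverts H) I)
    = 2 ^ (card (hverts H) - card W) * card (saturated_sets H W I)"
proof -
  have W: "W \<subseteq> hverts H" using I edge_subset by (auto simp: W_def)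
  have "bij_betw (\<lambda>A. (A - W, A \<inter> W)) (saturated_sets H (hverts H) I)
    (Pow (hverts H - W) \<times> saturated_sets H W I)"
  proof (rule bij_betw_byWitness[of _ "\<lambda>(B, A). B \<union> A"])
    show "\<forall>p\<in>Pow (hverts H - W) \<times> saturated_sets H W I.
        ((case p of (B, A) \<Rightarrow> B \<union> A) - W, (case p of (B, A) \<Rightarrow> B \<union> A) \<inter> W) = p"
      by (auto simp: saturated_sets_def)
    have in_W: "hset H e \<subseteq> W" if "e \<in> I" for e using that by (auto simp: W_def)
    show "(\<lambda>A. (A - W, A \<inter> W)) ` saturated_sets H (hverts H) I
        \<subseteq> Pow (hverts H - W) \<times> saturated_sets H W I"
    proof (rule image_subsetI)
      fix A assume "A \<in> saturated_sets H (hverts H) I"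
      then have "A - W \<subseteq> hverts H - W" "A \<inter> W \<in> saturated_sets H W I"
        using in_W unfolding saturated_sets_def by blast+
      then show "(A - W, A \<inter> W) \<in> Pow (hverts H - W) \<times> saturated_sets H W I" by simp
    qed
    have "B \<union> A \<in> saturated_sets H (hverts H) I"
      if BA: "B \<subseteq> hverts H - W" "A \<in> saturated_sets H W I" for B A
    proof -
      have "hset H e \<subseteq> B \<union> A \<or> hset H e \<inter> (B \<union> A) = {}" if "e \<in> I" for e
      proof -
        have "hset H e \<inter> B = {}" using in_W[OF that] BA(1) by blast
        moreover have "hset H e \<subseteq> A \<or> hset H e \<inter> A = {}"
          using BA(2) that by (auto simp: saturated_sets_def)
        ultimately show ?thesis by blast
      qed
      moreover have "B \<union> A \<subseteq> hverts H" using BA W by (auto simp: saturated_sets_def)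
      ultimately show ?thesis by (simp add: saturated_sets_def)
    qed
    then show "(\<lambda>(B, A). B \<union> A) ` (Pow (hverts H - W) \<times> saturated_sets H W I)
        \<subseteq> saturated_sets H (hverts H) I"
      by auto
  qed auto
  then have "card (saturated_sets H (hverts H) I)
      = card (Pow (hverts H - W)) * card (saturated_sets H W I)"
    unfolding card_cartesian_product[symmetric] by (rule bij_betw_same_card)
  then show ?thesis
    using finite_subset[OF W finite_verts] W finite_verts by (simp add: card_Pow card_Diff_subset)
qed

text \<open>Each vertex missed by \<open>I\<close> adds 1 to the exponent \<open>n\<close> and to
  the number of vertices, so it cancels in the difference. This describes \<open>mu\<close>
  uniformly, including the empty set.\<close>

lemma mu_exponent:
  assumes "I \<subseteq> hedges H"
  obtains n where "card (saturated_sets H (hverts H) I) = 2 ^ n" "mu H I = int (card (hverts H)) - int n"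
proof (cases "I = {}")
  case True
  then have "saturated_sets H (hverts H) I = Pow (hverts H)" by (auto simp: saturated_sets_def)
  then show ?thesis using that[of "card (hverts H)"] True finite_verts by (simp add: mu_def card_Pow)
next
  case False
  let ?W = "\<Union>e\<in>I. hset H e"
  have W: "?W \<subseteq> hverts H" using assms edge_subset by auto
  then have le: "card ?W \<le> card (hverts H)" using finite_verts by (rule card_mono[rotated])
  let ?n = "card (hverts H) - card ?W + num_components (Bip_restrict H I)"
  have "card (saturated_sets H (hverts H) I) = 2 ^ ?n"
    unfolding power_add Bip_restrict_def
    using card_saturated_sets_extend[OF assms] card_saturated_sets[OF W assms subset_refl] by simp
  moreover have "mu H I = int (card (hverts H)) - int ?n"
    using False le by (simp add: mu_def of_nat_diff)
  ultimately show ?thesis by (rule that)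
qed

lemma mu_mono:
  assumes "I \<subseteq> J" "J \<subseteq> hedges H"
  shows "mu H I \<le> mu H J"
proof -
  let ?S = "saturated_sets H (hverts H)"
  obtain m where m: "card (?S I) = 2 ^ m" "mu H I = int (card (hverts H)) - int m"
    using mu_exponent[of I] assms by auto
  obtain n where n: "card (?S J) = 2 ^ n" "mu H J = int (card (hverts H)) - int n"
    using mu_exponent[of J] assms by auto
  have "?S J \<subseteq> ?S I" using assms by (auto simp: saturated_sets_def)
  then have "card (?S J) \<le> card (?S I)"
    by (rule card_mono[OF finite_saturated_sets[OF finite_verts]])
  then show ?thesis using m n by simp
qed

text \<open>The product inequality for saturated sets, read off in exponents of 2.\<close>

lemma mu_submodular:
  assumes "I \<subseteq> hedges H" "J \<subseteq> hedges H"
  shows "mu H (I \<union> J) + mu H (I \<inter> J) \<le> mu H I + mu H J"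
proof -
  let ?S = "saturated_sets H (hverts H)" and ?v = "int (card (hverts H))"
  obtain m where m: "card (?S I) = 2 ^ m" "mu H I = ?v - int m"
    using mu_exponent[of I] assms by auto
  obtain n where n: "card (?S J) = 2 ^ n" "mu H J = ?v - int n"
    using mu_exponent[of J] assms by auto
  obtain p where p: "card (?S (I \<inter> J)) = 2 ^ p" "mu H (I \<inter> J) = ?v - int p"
    using mu_exponent[of "I \<inter> J"] assms by auto
  obtain q where q: "card (?S (I \<union> J)) = 2 ^ q" "mu H (I \<union> J) = ?v - int q"
    using mu_exponent[of "I \<union> J"] assms by auto
  have "(2::nat) ^ (m + n) \<le> 2 ^ (p + q)"
    using card_saturated_sets_submodular[OF finite_verts, of H I J] m n p q by (simp add: power_add)
  then have "m + n \<le> p + q" by simp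
  then show ?thesis using m n p q by linarith
qed

text \<open>The empty set and the whole vertex set are distinct saturated sets, so the exponent is
  at least 1.\<close>

lemma mu_le:
  assumes "I \<subseteq> hedges H" "hverts H \<noteq> {}"
  shows "mu H I \<le> int (card (hverts H)) - 1"
proof -
  obtain n where n: "card (saturated_sets H (hverts H) I) = 2 ^ n"
      "mu H I = int (card (hverts H)) - int n"
    using mu_exponent[of I] assms by auto
  have "{{}, hverts H} \<subseteq> saturated_sets H (hverts H) I"
    using assms edge_subset by (auto simp: saturated_sets_def)
  then have "card {{}, hverts H} \<le> card (saturated_sets H (hverts H) I)"
    by (rule card_mono[OF finite_saturated_sets[OF finite_verts]])
  then have "2 \<le> (2::nat) ^ n" using assms n by simp
  then have "n \<noteq> 0" by (intro notI) simp
  then show ?thesis using n by simp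
qed

lemma connected_Bip_delete_iff:
  "connected (Bip_delete H D) \<longleftrightarrow> mu H (hedges H - D) = int (card (hverts H)) - 1"
proof -
  let ?I = "hedges H - D"
  obtain n where n: "card (saturated_sets H (hverts H) ?I) = 2 ^ n"
      "mu H ?I = int (card (hverts H)) - int n"
    using mu_exponent[of ?I] by auto
  have "pverts (Bip H) - Inr ` D = Inl ` hverts H \<union> Inr ` ?I" by (auto simp: Bip_def)
  then have "connected (Bip_delete H D) \<longleftrightarrow> card (saturated_sets H (hverts H) ?I) = 2"
    using connected_iff_card_saturated_sets[of "hverts H" ?I] edge_subset
    by (auto simp: Bip_delete_def)
  also have "\<dots> \<longleftrightarrow> (2::nat) ^ n = 2 ^ 1" using n by simp
  also have "\<dots> \<longleftrightarrow> n = 1" by (subst power_inject_exp) auto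
  finally show ?thesis using n by simp
qed

lemma Bip_delete_empty: "Bip_delete H {} = with_proj (Bip H)"
  by (auto simp: Bip_delete_def induce_subgraph_def with_proj_def Bip_def
      dest: subsetD[OF edge_subset])

end

subsection \<open>The exterior polynomial of a hypergraph\<close>

text \<open>Counting predecessors turns the order relation into the numerical positions required by
  \<open>ordered_integer_polymatroid\<close>.\<close>

lemma linear_order_on_iff_card_less:
  assumes lin: "linear_order_on A r" and fin: "finite A" and xy: "x \<in> A" "y \<in> A"
  defines "pos \<equiv> \<lambda>y. card {x \<in> A. (x, y) \<in> r}"
  shows "(x, y) \<in> r \<and> x \<noteq> y \<longleftrightarrow> pos x < pos y"
proof -
  have refl: "\<And>x. x \<in> A \<Longrightarrow> (x, x) \<in> r" and trans: "trans r" and anti: "antisym r"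
    and total: "total_on A r"
    using lin by (auto simp: order_on_defs refl_on_def)
  have less: "pos x < pos y" if "(x, y) \<in> r" "x \<noteq> y" "x \<in> A" "y \<in> A" for x y
  proof -
    have "(y, x) \<notin> r" using that anti by (auto dest: antisymD)
    then have "{z \<in> A. (z, x) \<in> r} \<subset> {z \<in> A. (z, y) \<in> r}"
      using that refl trans by (auto dest: transD)
    then show ?thesis unfolding pos_def using fin by (intro psubset_card_mono) auto
  qed
  show ?thesis
  proof
    assume "pos x < pos y"
    then have "x \<noteq> y" "(y, x) \<notin> r" using less[of y x] xy by auto
    then show "(x, y) \<in> r \<and> x \<noteq> y" using total xy by (auto simp: total_on_def)
  qed (use less xy in blast)
qed

text \<open>Natural subtraction truncates only for \<open>n = i = 0\<close>, where the upper
  argument is -1 on the left and 0 on the right, but both sides are 1.\<close>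

lemma of_nat_gbinomial_pred:
  "(of_nat n + of_nat i - 1 :: rat) gchoose i = of_nat ((n + i - 1) choose i)"
proof (cases "n + i")
  case (Suc m)
  then have "(of_nat n + of_nat i - 1 :: rat) = of_nat (n + i - 1)"
    by (metis add_diff_cancel_right' diff_Suc_1 of_nat_Suc of_nat_add add.commute)
  then show ?thesis by (simp only: binomial_gbinomial)
qed simp

theorem theorem5p9:
  fixes H :: "('v, 'e) hypergraph" and r :: "'e rel" and k :: nat
  assumes "is_hypergraph H"
    and "linear_order_on (hedges H) r"
    and "k \<le> card (hedges H)"
    and "k = 0 \<Longrightarrow> Digraph_Component.connected (with_proj (Bip H))"
  shows "(\<forall>i\<le>k. (of_int (poly.coeff (exterior_polynomial H r) i) :: rat)
             = (of_nat (card (hverts H)) + of_nat i - 2) gchoose i)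
    \<longleftrightarrow> (\<forall>E'\<subseteq>hedges H. card E' = k \<longrightarrow> Digraph_Component.connected (Bip_delete H E'))"
proof -
  interpret finite_hypergraph H by unfold_locales (rule assms)
  define pos where "pos y = card {x \<in> hedges H. (x, y) \<in> r}" for y
  have pos: "(x, y) \<in> r \<and> x \<noteq> y \<longleftrightarrow> pos x < pos y" if "x \<in> hedges H" "y \<in> hedges H" for x y
    using linear_order_on_iff_card_less[OF assms(2) finite_edges that] unfolding pos_def .
  interpret P: ordered_integer_polymatroid "hedges H" "mu H" pos
  proof
    show "inj_on pos (hedges H)"
    proof (rule inj_onI)
      fix x y assume "x \<in> hedges H" "y \<in> hedges H" "pos x = pos y"
      then show "x = y" using pos[of x y] pos[of y x] assms(2)
        by (auto simp: order_on_defs total_on_def)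
    qed
  qed (simp_all add: finite_edges mu_mono mu_submodular, simp add: mu_def)
  have bases: "bases H = P.base_points"
    by (simp add: bases_def P.base_points_def)
  have "externally_active H r a = P.ext_active a" for a
    using pos unfolding externally_active_def P.ext_active_def bases P.shift_def unit_vec_def
    by auto
  then have X: "exterior_polynomial H r = P.ext_poly"
    by (simp add: exterior_polynomial_def P.ext_poly_def bases)
  have conn_iff: "Digraph_Component.connected (Bip_delete H E')
      \<longleftrightarrow> mu H (hedges H - E') = int (card (hverts H)) - 1" for E'
    by (rule connected_Bip_delete_iff)
  have k0: "mu H (hedges H) = int (card (hverts H)) - 1" if "k = 0"
    using assms(4)[OF that] conn_iff[of "{}"] by (simp add: Bip_delete_empty)
  \<comment> \<open>For \<open>k = 0\<close> an empty vertex set would give rank -1; for positive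
    \<open>k\<close> there is a hyperedge, and it is nonempty.\<close>
  have ne: "hverts H \<noteq> {}"
  proof (cases "k = 0")
    case True
    then show ?thesis using k0 P.rank_nonneg[of "hedges H"] by auto
  next
    case False
    then obtain e where "e \<in> hedges H" using assms(3) by fastforce
    then show ?thesis using edge_nonempty edge_subset by blast
  qed
  then obtain n where n: "card (hverts H) = Suc n"
    using finite_verts by (metis card_eq_0_iff not0_implies_Suc)
  have le: "mu H I \<le> int n" if "I \<subseteq> hedges H" for I
    using mu_le[OF that ne] n by simp
  have gchoose: "(of_nat (card (hverts H)) + of_nat i - 2 :: rat) gchoose i
      = of_int (int ((n + i - 1) choose i))" for i
    using of_nat_gbinomial_pred[of n i] by (simp add: n algebra_simps)
  have L: "(\<forall>i\<le>k. (of_int (poly.coeff (exterior_polynomial H r) i) :: rat)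
             = (of_nat (card (hverts H)) + of_nat i - 2) gchoose i)
      \<longleftrightarrow> (\<forall>i\<le>k. coeff P.ext_poly i = int ((n + i - 1) choose i))"
    unfolding gchoose X of_int_eq_iff ..
  have R: "(\<forall>E'\<subseteq>hedges H. card E' = k \<longrightarrow> Digraph_Component.connected (Bip_delete H E'))
      \<longleftrightarrow> (\<forall>E'\<subseteq>hedges H. card E' = k \<longrightarrow> mu H (hedges H - E') = int n)"
    by (simp add: conn_iff n)
  show ?thesis
  proof (cases "mu H (hedges H) = int n")
    case True
    then show ?thesis using P.ext_poly_coeffs_iff[OF assms(3)] unfolding L R by simp
  next
    case False
    \<comment> \<open>Both sides fail here. Connectedness at \<open>k = 0\<close> forces
      \<open>k\<close> to be positive, and the coefficient of y is at most the rank, hence below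
      \<open>n choose 1\<close>.\<close>
    then have less: "mu H (hedges H) < int n" using le[of "hedges H"] by simp
    then have "1 \<le> k" using k0 n by (cases k) auto
    moreover have "coeff P.ext_poly 1 < int ((n + 1 - 1) choose 1)"
      using P.coeff_1_ext_poly_le less by simp
    ultimately have "\<not> (\<forall>i\<le>k. coeff P.ext_poly i = int ((n + i - 1) choose i))"
      by (metis less_irrefl)
    \<comment> \<open>A set of size \<open>k\<close> exists, so the right-hand side is not vacuously
      true.\<close>
    moreover obtain D where D: "D \<subseteq> hedges H" "card D = k"
      using assms(3) obtain_subset_with_card_n by metis
    moreover have "mu H (hedges H - D) < int n"
      using mu_mono[of "hedges H - D" "hedges H"] less by simp
    ultimately show ?thesis unfolding L R by (metis less_irrefl)
  qed
qed

end
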